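(* Let $\phi\in\mathcal{S}(\mathbb{R})\setminus\{0\}$ be such that $\gamma\mapsto|\widehat{\phi}(\gamma)|$ and $\gamma\mapsto|\widehat{\phi}(-\gamma)|$ are ultimately decreasing. Then every finite wavelet system generated by $\phi$ is linearly independent.
   Context: $\mathcal{S}(\mathbb{R})$ is the space of complex-valued Schwartz functions on $\mathbb{R}$, and $\widehat{\phi}(\gamma)=\int_{\mathbb{R}}\phi(x)e^{-2\pi i x\gamma}\,dx$ is the Fourier transform. A function is ultimately decreasing if there is $A>0$ such that it is decreasing (in the non-strict sense) on $(A,\infty)$. For a finite set $\Lambda=\{(\lambda_k,\beta_k)\}_{k=1}^N\subset(0,\infty)\times\mathbb{R}$ of distinct points, the finite wavelet system generated by $\phi$ and parameterized by $\Lambda$ is $\mathcal{W}(\phi,\Lambda)=\{\phi(\lambda_kx-\beta_k)\}_{k=1}^N$. It is linearly independent if $\sum_{k=1}^Nc_k\phi(\lambda_kx-\beta_k)=0$ for almost every $x$, with $c_k\in\mathbb{C}$, implies that all $c_k=0$. *)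

theory Defs
  imports "HOL-Analysis.Analysis"
begin

definition nth_vderiv :: "nat \<Rightarrow> (real \<Rightarrow> complex) \<Rightarrow> real \<Rightarrow> complex" where
  "nth_vderiv n f = ((\<lambda>g x. vector_derivative g (at x)) ^^ n) f"

text \<open>The first conjunct says that \<open>f\<close> is infinitely often (real) differentiable; it is what
  makes the \<^const>\<open>vector_derivative\<close> terms of the second conjunct meaningful.\<close>

definition schwartz_space :: "(real \<Rightarrow> complex) set" where
  "schwartz_space = {f.
     (\<forall>n x. nth_vderiv n f differentiable (at x)) \<and>
     (\<forall>m n. bounded (range (\<lambda>x. x ^ m *\<^sub>R nth_vderiv n f x)))}"

definition fourier_transform :: "(real \<Rightarrow> complex) \<Rightarrow> real \<Rightarrow> complex" where
  "fourier_transform \<phi> \<gamma> =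
     (LINT x|lborel. \<phi> x * exp (- 2 * complex_of_real pi * \<i> * complex_of_real x * complex_of_real \<gamma>))"

definition ultimately_decreasing :: "(real \<Rightarrow> real) \<Rightarrow> bool" where
  "ultimately_decreasing g \<longleftrightarrow> (\<exists>A>0. antimono_on {A<..} g)"

definition wavelet :: "(real \<Rightarrow> complex) \<Rightarrow> real \<times> real \<Rightarrow> real \<Rightarrow> complex" where
  "wavelet \<phi> = (\<lambda>(l, b) x. \<phi> (l * x - b))"

text \<open>Linear independence of the family \<open>(f k)\<^sub>k\<close> indexed by a finite set \<open>I\<close>, for functions
  modulo equality almost everywhere. It is a property of the indexed family, not of the set
  \<open>f ` I\<close>: in particular it fails if two members coincide.\<close>

definition ae_linearly_independent :: "'k set \<Rightarrow> ('k \<Rightarrow> real \<Rightarrow> complex) \<Rightarrow> bool" where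
  "ae_linearly_independent I f \<longleftrightarrow>
     (\<forall>c :: 'k \<Rightarrow> complex. (AE x in lborel. (\<Sum>k\<in>I. c k * f k x) = 0) \<longrightarrow> (\<forall>k\<in>I. c k = 0))"

end

theory Submission
  imports Defs "HOL-Probability.Probability"
begin

text \<open>On the Fourier side a vanishing linear combination reads
  \<open>\<Sum>\<^sub>\<lambda> F(\<gamma> / \<lambda>) Q\<^sub>\<lambda>(\<gamma>) = 0\<close>, where \<open>F\<close> is the Fourier transform of \<open>\<phi>\<close> and the \<open>Q\<^sub>\<lambda>\<close> are
  trigonometric polynomials. Isolate the largest scale \<open>\<lambda>\<^sub>1\<close> that occurs, let \<open>\<lambda>\<^sub>2 < \<lambda>\<^sub>1\<close> bound the other
  scales, and put \<open>a = \<lambda>\<^sub>1 / \<lambda>\<^sub>2\<close>. Monotonicity of \<open>|F|\<close> gives \<open>|F(x)| |Q(\<lambda>\<^sub>1 x)| \<le> C |F(a x)|\<close> for large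
  \<open>x\<close>. Since \<open>|Q|\<close> is bounded below by some \<open>\<epsilon> > 0\<close> at some point of every interval of a given length,
  monotonicity also allows one to move \<open>x\<close> to such a point, so that \<open>|F(x)| \<le> K |F(r x)|\<close> for any fixed
  \<open>r\<close> between 1 and \<open>a\<close>. Iterating contradicts the rapid decay of \<open>F\<close>, unless \<open>F\<close> vanishes near infinity.
  In that case the top scale term alone survives near the edge of its support, which forces \<open>Q\<close> to vanish
  on an interval.\<close>

subsection \<open>Trigonometric polynomials and dilations\<close>

text \<open>Induction on the number of frequencies: a twisted difference removes one frequency, and
  its lower bound on a window of length \<open>L/2\<close> passes, halved, to \<open>Q\<close> at
  one of the two points compared. Singling out \<open>k0\<close> keeps a nonzero coefficient through
  the induction, while the others may vanish.\<close>

lemma trig_polynomial_lower_bound_insert: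
  fixes b :: "'k \<Rightarrow> real" and c :: "'k \<Rightarrow> complex"
  assumes "finite K" "inj_on b (insert k0 K)" "k0 \<notin> K" "c k0 \<noteq> 0" "L > 0"
  shows "\<exists>\<epsilon>>0. \<forall>t. \<exists>s\<in>{t..t+L}. \<epsilon> \<le> cmod (\<Sum>k\<in>insert k0 K. c k * cis (b k * s))"
  using assms
proof (induction K arbitrary: c L rule: finite_induct)
  case empty
  then show ?case
    by (intro exI[of _ "cmod (c k0)"]) (auto simp: norm_mult)
next
  case (insert k1 K)
  define d where "d = \<bar>b k0 - b k1\<bar>"
  have "k0 \<noteq> k1" using insert.prems by auto
  then have "b k0 \<noteq> b k1"
    using inj_onD[OF insert.prems(1), of k0 k1] by blast
  then have d: "d > 0" by (simp add: d_def)
  \<comment> \<open>The bound \<open>L/2\<close> keeps \<open>s + h\<close> inside the window of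
    length \<open>L\<close>. The bound \<open>pi / d\<close> gives
    \<open>0 < d * h \<le> pi\<close>, where injectivity of cosine separates the rotations of
    frequencies \<open>b k0\<close> and \<open>b k1\<close>.\<close>
  define h where "h = min (L/2) (pi / d)"
  have h: "h > 0" "h \<le> L/2" "d * h \<le> pi"
    using insert.prems d by (auto simp: h_def min_def field_simps)
  define Q where "Q = (\<lambda>s. \<Sum>k\<in>insert k0 (insert k1 K). c k * cis (b k * s))"
  define c' where "c' = (\<lambda>k. c k * (cis (b k * h) - cis (b k1 * h)))"
  have ne: "cis (b k0 * h) \<noteq> cis (b k1 * h)"
  proof
    assume eq: "cis (b k0 * h) = cis (b k1 * h)"
    define u where "u = b k0 * h - b k1 * h"
    have "cis u = 1" unfolding u_def cis_divide[symmetric] eq by simp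
    then have "Re (cis u) = Re 1" by (rule arg_cong)
    then have "cos \<bar>u\<bar> = cos 0" by simp
    moreover have "\<bar>u\<bar> = d * h"
      using h(1) abs_mult[of "b k0 - b k1" h] unfolding d_def u_def by (simp add: left_diff_distrib)
    moreover have "0 < d * h" using d h(1) by simp
    ultimately show False using cos_inj_pi[of "d * h" 0] h(3) by force
  qed
  \<comment> \<open>A finite difference with step \<open>h\<close> annihilates the frequency \<open>b k1\<close> but not \<open>b k0\<close>.\<close>
  have Q: "Q (s + h) - cis (b k1 * h) * Q s = (\<Sum>k\<in>insert k0 K. c' k * cis (b k * s))" for s
  proof -
    have "Q (s + h) - cis (b k1 * h) * Q s = (\<Sum>k\<in>insert k1 (insert k0 K). c' k * cis (b k * s))"
      unfolding Q_def sum_distrib_left sum_subtractf[symmetric] insert_commute[of k1]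
    proof (intro sum.cong refl)
      fix k
      have "cis (b k * (s + h)) = cis (b k * s) * cis (b k * h)"
        by (simp add: cis_mult distrib_left)
      then show "c k * cis (b k * (s + h)) - cis (b k1 * h) * (c k * cis (b k * s)) = c' k * cis (b k * s)"
        by (simp add: c'_def algebra_simps)
    qed
    then show ?thesis
      using insert.hyps \<open>k0 \<noteq> k1\<close> by (simp add: c'_def)
  qed
  obtain e where e: "e > 0" "\<And>t. \<exists>s\<in>{t..t+L/2}. e \<le> cmod (\<Sum>k\<in>insert k0 K. c' k * cis (b k * s))"
  proof -
    have "inj_on b (insert k0 K)" "k0 \<notin> K" "c' k0 \<noteq> 0" "L / 2 > 0"
      using insert.prems ne by (auto simp: c'_def)
    from insert.IH[where c=c' and L="L/2", OF this] show ?thesis using that by blast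
  qed
  have "\<exists>s\<in>{t..t+L}. e/2 \<le> cmod (Q s)" for t
  proof -
    obtain s where s: "s \<in> {t..t+L/2}" "e \<le> cmod (Q (s + h) - cis (b k1 * h) * Q s)"
      using e(2)[of t] unfolding Q by blast
    have "cmod (Q (s + h) - cis (b k1 * h) * Q s) \<le> cmod (Q (s + h)) + cmod (Q s)"
      using norm_triangle_ineq4[of "Q (s + h)" "cis (b k1 * h) * Q s"] by (simp add: norm_mult)
    then have "e/2 \<le> cmod (Q (s + h)) \<or> e/2 \<le> cmod (Q s)"
      using s(2) by linarith
    then show ?thesis
      using s(1) h(1,2) by (auto intro: bexI[of _ "s+h"] bexI[of _ s])
  qed
  then show ?case
    using e(1) unfolding Q_def by (intro exI[of _ "e/2"]) auto
qed

lemma trig_polynomial_lower_bound: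
  fixes b :: "'k \<Rightarrow> real" and c :: "'k \<Rightarrow> complex"
  assumes "finite K" "inj_on b K" "k0 \<in> K" "c k0 \<noteq> 0" "L > 0"
  obtains \<epsilon> where "\<epsilon> > 0" "\<And>t. \<exists>s\<in>{t..t+L}. \<epsilon> \<le> cmod (\<Sum>k\<in>K. c k * cis (b k * s))"
  using trig_polynomial_lower_bound_insert[of "K - {k0}" b k0 c L] assms
  by (auto simp: insert_absorb)

text \<open>Iteration gives \<open>\<psi> X \<le> K ^ n * \<psi> (b ^ n * X)\<close>. Decay of an
  order \<open>m\<close> with \<open>K < b ^ m\<close> beats the factor \<open>K ^ n\<close>, so the
  bound tends to 0.\<close>

lemma geometric_growth_decay_imp_zero:
  fixes \<psi> :: "real \<Rightarrow> real"
  assumes "X > 0" "b > 1" "K \<ge> 0" "\<And>x. 0 \<le> \<psi> x"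
    and step: "\<And>x. X \<le> x \<Longrightarrow> \<psi> x \<le> K * \<psi> (b * x)"
    and decay: "\<And>m. \<exists>M. \<forall>x>0. x ^ m * \<psi> x \<le> M"
  shows "\<psi> X = 0"
proof -
  have bX: "X \<le> b ^ n * X" for n
    using assms(1,2) by simp
  have iter: "\<psi> X \<le> K ^ n * \<psi> (b ^ n * X)" for n
  proof (induction n)
    case (Suc n)
    have "\<psi> (b ^ n * X) \<le> K * \<psi> (b ^ Suc n * X)"
      using step[OF bX[of n]] by (simp add: mult.assoc)
    then have "K ^ n * \<psi> (b ^ n * X) \<le> K ^ n * (K * \<psi> (b ^ Suc n * X))"
      using assms(3) by (intro mult_left_mono) auto
    then show ?case using Suc by (simp add: algebra_simps)
  qed simp
  obtain m where m: "K < b ^ m"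
    using real_arch_pow[OF assms(2)] by blast
  obtain M where M: "\<And>x. x > 0 \<Longrightarrow> x ^ m * \<psi> x \<le> M"
    using decay by blast
  have bound: "X ^ m * \<psi> X \<le> M * (K / b ^ m) ^ n" for n
  proof -
    have "(b ^ n * X) ^ m * \<psi> (b ^ n * X) \<le> M"
      using assms(1,2) by (intro M) auto
    then have "K ^ n * (X ^ m * \<psi> (b ^ n * X)) * (b ^ m) ^ n \<le> K ^ n * M"
      using mult_left_mono[of "(b ^ n * X) ^ m * \<psi> (b ^ n * X)" M "K ^ n"] assms(3)
      by (simp add: power_mult_distrib algebra_simps flip: power_mult)
    moreover have "X ^ m * \<psi> X * (b ^ m) ^ n \<le> X ^ m * (K ^ n * \<psi> (b ^ n * X)) * (b ^ m) ^ n"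
      using iter[of n] assms(1,2) by (intro mult_left_mono mult_right_mono) auto
    ultimately have "X ^ m * \<psi> X * (b ^ m) ^ n \<le> K ^ n * M"
      by (simp add: algebra_simps)
    then show ?thesis
      using assms(2) by (simp add: power_divide field_simps)
  qed
  have "(\<lambda>n. M * (K / b ^ m) ^ n) \<longlonglongrightarrow> M * 0"
    using m assms(2,3) by (intro tendsto_mult tendsto_const LIMSEQ_realpow_zero) auto
  then have "X ^ m * \<psi> X \<le> M * 0"
    using bound by (intro LIMSEQ_le_const) auto
  then show ?thesis
    using zero_less_power[OF assms(1), of m] assms(4)[of X]
    by (simp add: mult_le_0_iff order_antisym)
qed

text \<open>Everything is stated on the positive half-line, so that the result applies both to a
  Fourier transform and to its reflection, whichever is nonzero at some positive point.\<close>

lemma dilation_relation_trivial: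
  fixes F :: "real \<Rightarrow> complex" and l b :: "'k \<Rightarrow> real" and c :: "'k \<Rightarrow> complex"
  assumes "finite K" and inj: "inj_on (\<lambda>k. (l k, b k)) K" and lpos: "\<And>k. k \<in> K \<Longrightarrow> l k > 0"
    and cont: "continuous_on UNIV F"
    and ud: "ultimately_decreasing (\<lambda>x. cmod (F x))"
    and decay: "\<And>m. \<exists>M. \<forall>x>0. x ^ m * cmod (F x) \<le> M"
    and nz: "z > 0" "F z \<noteq> 0"
    and rel: "\<And>t. t > 0 \<Longrightarrow> (\<Sum>k\<in>K. c k * F (t / l k) * cis (b k * t)) = 0"
  shows "\<forall>k\<in>K. c k = 0"
proof (rule ccontr)
  assume nonzero: "\<not> (\<forall>k\<in>K. c k = 0)"
  \<comment> \<open>Zero coefficients are dropped first, so that the largest scale \<open>l1\<close>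
    really occurs.\<close>
  define S where "S = {k\<in>K. c k \<noteq> 0}"
  have S: "finite S" "S \<noteq> {}" "S \<subseteq> K"
    using \<open>finite K\<close> nonzero by (auto simp: S_def)
  define l1 where "l1 = Max (l ` S)"
  define T where "T = {k\<in>S. l k = l1}"
  have le1: "l k \<le> l1" if "k \<in> S" for k
    using S that by (simp add: l1_def)
  obtain k0 where k0: "k0 \<in> S" "l k0 = l1"
  proof -
    have "l1 \<in> l ` S" unfolding l1_def using S by (intro Max_in) auto
    then show ?thesis using that by auto
  qed
  have l1: "l1 > 0" using k0 lpos S by auto
  \<comment> \<open>The extra element \<open>l1/2\<close> keeps \<open>l2\<close> positive and well
    defined when every term has scale \<open>l1\<close>.\<close>
  define l2 where "l2 = Max (insert (l1/2) (l ` (S - T)))"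
  have l2: "0 < l2" "l2 < l1"
  proof -
    have "l1/2 \<le> l2" unfolding l2_def using S by (intro Max_ge) auto
    then show "0 < l2" using l1 by linarith
    have "l k < l1" if "k \<in> S - T" for k
      using le1[of k] that by (auto simp: T_def)
    then show "l2 < l1"
      unfolding l2_def using S l1 by (subst Max_less_iff) auto
  qed
  have le2: "l k \<le> l2" if "k \<in> S - T" for k
    using S that by (auto simp: l2_def)
  \<comment> \<open>The scale is constant on \<open>T\<close>, so distinct pairs there have distinct
    frequencies.\<close>
  have T: "finite T" "inj_on b T" "k0 \<in> T" "c k0 \<noteq> 0" "T \<subseteq> S"
    using S(1) k0 inj by (simp_all add: T_def inj_on_def) (auto simp: S_def)
  define Q where "Q = (\<lambda>s. \<Sum>k\<in>T. c k * cis (b k * s))"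
  have top: "F (t / l1) * Q t = - (\<Sum>k\<in>S-T. c k * F (t / l k) * cis (b k * t))" if "t > 0" for t
  proof -
    have "(\<Sum>k\<in>K. c k * F (t / l k) * cis (b k * t)) = (\<Sum>k\<in>S. c k * F (t / l k) * cis (b k * t))"
      using \<open>finite K\<close> by (intro sum.mono_neutral_right) (auto simp: S_def)
    then have "0 = (\<Sum>k\<in>S. c k * F (t / l k) * cis (b k * t))"
      using rel[OF that] by simp
    also have "\<dots> = (\<Sum>k\<in>S-T. c k * F (t / l k) * cis (b k * t)) + (\<Sum>k\<in>T. c k * F (t / l k) * cis (b k * t))"
      using S(1) T(5) by (rule sum.subset_diff[rotated])
    also have "(\<Sum>k\<in>T. c k * F (t / l k) * cis (b k * t)) = F (t / l1) * Q t"
      unfolding Q_def sum_distrib_left by (intro sum.cong) (auto simp: T_def)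
    finally show ?thesis by (simp add: eq_neg_iff_add_eq_0 add.commute)
  qed
  have Qbound: "\<exists>e>0. \<forall>t. \<exists>s\<in>{t..t+L}. e \<le> cmod (Q s)" if "L > 0" for L
    using trig_polynomial_lower_bound[where c=c, OF T(1-4) that] unfolding Q_def by metis
  obtain A where A: "A > 0" "\<And>x y. A < x \<Longrightarrow> x \<le> y \<Longrightarrow> cmod (F y) \<le> cmod (F x)"
    using ud unfolding ultimately_decreasing_def monotone_on_def by auto
  define a where "a = l1 / l2"
  have a: "a > 1" using l2 by (simp add: a_def)
  show False
  \<comment> \<open>If \<open>F\<close> vanishes near infinity, compare supports; otherwise compare sizes.\<close>
  proof (cases "\<exists>R. \<forall>x\<ge>R. F x = 0")
    case True
    then obtain R where R: "\<And>x. x \<ge> R \<Longrightarrow> F x = 0" by blast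
    define U where "U = {x. x > 0 \<and> F x \<noteq> 0}"
    have bdd: "bdd_above U"
    proof (rule bdd_aboveI)
      show "x \<le> R" if "x \<in> U" for x using R[of x] that by (force simp: U_def)
    qed
    have z: "z \<in> U" using nz by (simp add: U_def)
    define s where "s = Sup U"
    have s: "s \<ge> z" "\<And>x. x > s \<Longrightarrow> F x = 0"
    proof -
      show "s \<ge> z" unfolding s_def using z bdd by (rule cSup_upper)
      then show "F x = 0" if "x > s" for x
        using cSup_upper[OF _ bdd, of x] that nz by (force simp: U_def s_def)
    qed
    \<comment> \<open>If \<open>t / l1 > s / a\<close>, then every smaller scale sees an argument at
      least \<open>t / l2 = a * (t / l1) > s\<close>, where \<open>F\<close> vanishes. A support
      point \<open>p\<close> beyond \<open>s / a\<close> therefore isolates the top term.\<close>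
    have "s / a < Sup U" using a s(1) nz(1) by (simp add: s_def field_simps)
    then obtain p where p: "p \<in> U" "s / a < p"
      using less_cSupD[of U "s/a"] z by blast
    have "open ({x. F x \<noteq> 0} \<inter> {s/a<..})"
      using cont open_Collect_neq[of F "\<lambda>_. 0"] by (intro open_Int) auto
    then obtain d where d: "d > 0" "cball p d \<subseteq> {x. F x \<noteq> 0} \<inter> {s/a<..}"
      using p by (force simp: U_def open_contains_cball)
    \<comment> \<open>Rescaled by \<open>l1\<close>, this window is \<open>[p, p + d]\<close>, on
      which \<open>F\<close> has no zero; \<open>Q\<close> is nonzero somewhere in it.\<close>
    obtain e t where e: "e > 0" "t \<in> {l1 * p .. l1 * p + l1 * d}" "e \<le> cmod (Q t)"
      using Qbound[of "l1 * d"] l1 d(1) by (meson mult_pos_pos)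
    have t: "t / l1 \<in> cball p d"
      using e(2) l1 by (auto simp: dist_real_def field_simps)
    then have "t / l1 > s / a" using d(2) by auto
    then have t2: "t / l2 > s" using l1 l2 s(1) nz(1) by (simp add: a_def field_simps)
    then have "t > 0" using l2 s(1) nz(1) by (smt (verit) zero_less_divide_iff)
    have "F (t / l k) = 0" if "k \<in> S - T" for k
    proof -
      have "l k > 0" using that S lpos by auto
      then have "t / l2 \<le> t / l k"
        using le2[OF that] \<open>t > 0\<close> by (intro divide_left_mono) (auto simp: l2)
      then show ?thesis using t2 s(2) by auto
    qed
    then have "F (t / l1) * Q t = 0"
      unfolding top[OF \<open>t > 0\<close>] by (simp add: sum.neutral)
    then show False
      using e t d(2) by auto
  next
    case False
    obtain e where e: "e > 0" "\<And>t. \<exists>s\<in>{t..t+l1}. e \<le> cmod (Q s)"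
      using Qbound[OF l1] by blast
    define C where "C = (\<Sum>k\<in>S-T. cmod (c k))"
    have C: "C \<ge> 0" by (simp add: C_def sum_nonneg)
    \<comment> \<open>Any \<open>r\<close> strictly between 1 and \<open>a\<close> absorbs the unit shift: \<open>r * x \<le> a * (x - 1)\<close> for large \<open>x\<close>.\<close>
    define r where "r = (1 + a) / 2"
    have r: "1 < r" "r < a" using a by (auto simp: r_def)
    \<comment> \<open>\<open>A + 2\<close> puts \<open>x - 1\<close> in the monotone range, and
      \<open>a / (a - r)\<close> solves \<open>r * x = a * (x - 1)\<close>.\<close>
    define X where "X = max (A + 2) (a / (a - r))"
    have step: "cmod (F x) \<le> (C / e) * cmod (F (r * x))" if "x \<ge> X" for x
    proof -
      have x: "x \<ge> A + 2" "r * x \<le> a * (x - 1)"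
        using that r by (auto simp: X_def field_simps)
      \<comment> \<open>Since \<open>s / l1\<close> lies in \<open>[x - 1, x]\<close>, monotonicity
        bounds \<open>|F x|\<close> by \<open>|F (s / l1)|\<close>. The other arguments are at least
        \<open>s / l2 \<ge> r * x\<close>, so their terms are controlled by
        \<open>|F (r * x)|\<close>.\<close>
      obtain s where s: "s \<in> {l1 * (x - 1)..l1 * (x - 1) + l1}" "e \<le> cmod (Q s)"
        using e(2) by blast
      have s1: "x - 1 \<le> s / l1" "s / l1 \<le> x"
        using s(1) l1 by (auto simp: field_simps)
      have "s > 0" using s1(1) x(1) A(1) l1 by (smt (verit) zero_less_divide_iff)
      have rs: "r * x \<le> s / l2"
      proof -
        have "a * (x - 1) \<le> a * (s / l1)" using s1 a by (intro mult_left_mono) auto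
        also have "\<dots> = s / l2" using l1 l2 by (simp add: a_def)
        finally show ?thesis using x by linarith
      qed
      have rx: "A < r * x"
      proof -
        have "1 * x \<le> r * x" using r x A by (intro mult_right_mono) auto
        then show ?thesis using x by linarith
      qed
      have "cmod (F (s / l k)) \<le> cmod (F (r * x))" if "k \<in> S - T" for k
      proof -
        have "l k > 0" using that S lpos by auto
        then have "s / l2 \<le> s / l k"
          using le2[OF that] \<open>s > 0\<close> by (intro divide_left_mono) (auto simp: l2)
        then show ?thesis using A(2) rx rs by auto
      qed
      then have "cmod (\<Sum>k\<in>S-T. c k * F (s / l k) * cis (b k * s)) \<le> C * cmod (F (r * x))"
        unfolding C_def sum_distrib_right
        by (intro sum_norm_le) (auto simp: norm_mult intro!: mult_left_mono)
      then have 1: "cmod (F (s / l1)) * cmod (Q s) \<le> C * cmod (F (r * x))"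
        using top[OF \<open>s > 0\<close>] by (metis norm_minus_cancel norm_mult)
      have "cmod (F x) * e \<le> cmod (F (s / l1)) * cmod (Q s)"
        using s(2) e(1) A(2)[of "s/l1" x] s1 x by (intro mult_mono) auto
      with 1 show ?thesis using e(1) by (simp add: field_simps)
    qed
    have "X > 0" using A by (simp add: X_def)
    have "cmod (F X) = 0"
      using \<open>X > 0\<close> r(1) C e(1) step decay
      by (intro geometric_growth_decay_imp_zero[of X r "C / e"]) auto
    then have "F x = 0" if "x \<ge> X" for x
      using A(2)[of X x] that by (auto simp: X_def)
    then show False using False by blast
  qed
qed

subsection \<open>The Fourier transform of integrable functions\<close>

lemma integrable_cis_mult:
  fixes f :: "real \<Rightarrow> complex"
  assumes "integrable lborel f"
  shows "integrable lborel (\<lambda>x. f x * cis (t * x))"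
proof (rule Bochner_Integration.integrable_bound[OF assms])
  have "(\<lambda>x. cis (t * x)) \<in> borel_measurable lborel"
    unfolding cis_conv_exp by measurable
  then show "(\<lambda>x. f x * cis (t * x)) \<in> borel_measurable lborel"
    using assms by (auto intro!: borel_measurable_times)
qed (auto simp: norm_mult)

lemma real_fourier_injective:
  fixes f :: "real \<Rightarrow> real"
  assumes f: "integrable lborel f"
    and zero: "\<And>t. (LINT x|lborel. of_real (f x) * cis (t * x)) = 0"
  shows "AE x in lborel. f x = 0"
proof -
  define p where "p = (\<lambda>x. max (f x) 0)"
  define q where "q = (\<lambda>x. max (- f x) 0)"
  have p: "integrable lborel p" "\<And>x. p x \<ge> 0" and q: "integrable lborel q" "\<And>x. q x \<ge> 0"
    using f by (auto simp: p_def q_def)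
  have [measurable]: "p \<in> borel_measurable lborel" "q \<in> borel_measurable lborel"
    using p q by auto
  have fpq: "f x = p x - q x" for x by (auto simp: p_def q_def)
  have eq: "(LINT x|lborel. complex_of_real (p x) * cis (t * x)) = (LINT x|lborel. of_real (q x) * cis (t * x))" for t
  proof -
    have "0 = (LINT x|lborel. complex_of_real (p x) * cis (t * x) - of_real (q x) * cis (t * x))"
      using zero[of t] by (simp add: fpq left_diff_distrib)
    also have "\<dots> = (LINT x|lborel. complex_of_real (p x) * cis (t * x)) - (LINT x|lborel. of_real (q x) * cis (t * x))"
      using p q by (intro Bochner_Integration.integral_diff integrable_cis_mult) auto
    finally show ?thesis by simp
  qed
  \<comment> \<open>The positive and negative parts of \<open>f\<close> have the same mass, so after normalisation they are
    densities of two probability distributions with equal characteristic functions.\<close>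
  define M where "M = (LINT x|lborel. p x)"
  have Mq: "(LINT x|lborel. q x) = M"
    using eq[of 0] by (simp add: M_def)
  have "M \<ge> 0" unfolding M_def using p by (intro integral_nonneg_AE) auto
  show ?thesis
  proof (cases "M = 0")
    \<comment> \<open>Zero mass cannot be normalised, but nonnegative functions with zero integral
      vanish almost everywhere.\<close>
    case True
    then have "AE x in lborel. p x = 0" "AE x in lborel. q x = 0"
      using integral_nonneg_eq_0_iff_AE[OF p(1)] integral_nonneg_eq_0_iff_AE[OF q(1)] Mq p q
      by (auto simp: M_def)
    then show ?thesis by eventually_elim (simp add: fpq)
  next
    case False
    with \<open>M \<ge> 0\<close> have M: "M > 0" by simp
    define D where "D = (\<lambda>g::real\<Rightarrow>real. density lborel (\<lambda>x. ennreal (g x / M)))"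
    have dist: "real_distribution (D g)" if "integrable lborel g" "\<And>x. g x \<ge> 0" "(LINT x|lborel. g x) = M" for g
    proof -
      have [measurable]: "g \<in> borel_measurable lborel" using that by auto
      have "emeasure (D g) UNIV = (\<integral>\<^sup>+x. ennreal (g x / M) \<partial>lborel)"
        unfolding D_def by (subst emeasure_density) auto
      also have "\<dots> = ennreal (LINT x|lborel. g x / M)"
        using that M by (intro nn_integral_eq_integral) auto
      also have "\<dots> = 1" using that M by simp
      finally have "emeasure (D g) (space (D g)) = 1" by (simp add: D_def)
      then have "prob_space (D g)" by (rule prob_spaceI)
      then show ?thesis
        by (auto simp: real_distribution_def real_distribution_axioms_def D_def)
    qed
    have ch: "char (D g) t = (LINT x|lborel. of_real (g x) * cis (t * x)) / M"
      if "integrable lborel g" "\<And>x. g x \<ge> 0" for g t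
    proof -
      have [measurable]: "g \<in> borel_measurable lborel" using that by auto
      have "char (D g) t = (LINT x|lborel. (g x / M) *\<^sub>R cis (t * x))"
        unfolding D_def char_def cis_conv_exp
        using that M by (subst integral_density) auto
      also have "\<dots> = (LINT x|lborel. (of_real (g x) * cis (t * x)) / M)"
        by (intro Bochner_Integration.integral_cong) (auto simp: scaleR_conv_of_real)
      finally show ?thesis by simp
    qed
    have "D p = D q"
      using dist[OF p] dist[OF q] Mq ch[OF p] ch[OF q] eq
      by (intro Levy_uniqueness) (auto simp: M_def)
    then have "AE x in lborel. ennreal (p x / M) = ennreal (q x / M)"
      unfolding D_def by (subst (asm) sigma_finite_measure.density_unique_iff[OF sigma_finite_lborel]) auto
    then show ?thesis
      by eventually_elim (use M p q in \<open>auto simp: fpq\<close>)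
  qed
qed

text \<open>Conjugation turns frequency \<open>t\<close> into \<open>-t\<close>, so
  \<open>cnj f\<close> satisfies the same vanishing condition. Hence so do the real and imaginary
  parts, and the real case applies.\<close>

lemma complex_fourier_injective:
  fixes f :: "real \<Rightarrow> complex"
  assumes f: "integrable lborel f"
    and zero: "\<And>t. (LINT x|lborel. f x * cis (t * x)) = 0"
  shows "AE x in lborel. f x = 0"
proof -
  have fc: "integrable lborel (\<lambda>x. cnj (f x))" using f by simp
  have c: "(LINT x|lborel. cnj (f x) * cis (t * x)) = 0" for t
  proof -
    have "(LINT x|lborel. cnj (f x) * cis (t * x)) = (LINT x|lborel. cnj (f x * cis (- t * x)))"
      by (intro Bochner_Integration.integral_cong) (auto simp: cis_cnj)
    also have "\<dots> = 0"
      using zero[of "-t"] by (simp del: complex_cnj_mult)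
    finally show ?thesis .
  qed
  have "AE x in lborel. Re (f x) = 0"
  proof (rule real_fourier_injective)
    fix t
    have "(LINT x|lborel. of_real (Re (f x)) * cis (t * x)) =
        (LINT x|lborel. (f x * cis (t * x) + cnj (f x) * cis (t * x)) / 2)"
      by (intro Bochner_Integration.integral_cong) (auto simp: complex_add_cnj simp flip: distrib_right)
    then show "(LINT x|lborel. of_real (Re (f x)) * cis (t * x)) = 0"
      using integrable_cis_mult[OF f, of t] integrable_cis_mult[OF fc, of t] zero[of t] c[of t] by simp
  qed (use f in auto)
  moreover have "AE x in lborel. Im (f x) = 0"
  proof (rule real_fourier_injective)
    fix t
    have "(LINT x|lborel. of_real (Im (f x)) * cis (t * x)) =
        (LINT x|lborel. (f x * cis (t * x) - cnj (f x) * cis (t * x)) / (2 * \<i>))"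
      by (intro Bochner_Integration.integral_cong) (auto simp: complex_diff_cnj field_simps simp flip: left_diff_distrib)
    then show "(LINT x|lborel. of_real (Im (f x)) * cis (t * x)) = 0"
      using integrable_cis_mult[OF f, of t] integrable_cis_mult[OF fc, of t] zero[of t] c[of t] by simp
  qed (use f in auto)
  ultimately show ?thesis
    by eventually_elim (simp add: complex_eq_iff)
qed

section \<open>Continuity, affine substitutions and derivatives under the Fourier transform\<close>

lemma fourier_transform_cis:
  "fourier_transform f \<gamma> = (LINT x|lborel. f x * cis ((- 2 * pi * \<gamma>) * x))"
  unfolding fourier_transform_def cis_conv_exp by (simp add: mult_ac)

lemma continuous_fourier_transform:
  assumes f: "integrable lborel f"
  shows "continuous_on UNIV (fourier_transform f)"
proof -
  have "isCont (fourier_transform f) \<gamma>" for \<gamma>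
    unfolding continuous_at_sequentially comp_def fourier_transform_cis
  proof (intro allI impI)
    fix u assume u: "u \<longlonglongrightarrow> \<gamma>"
    show "(\<lambda>n. LINT x|lborel. f x * cis (- 2 * pi * u n * x)) \<longlonglongrightarrow> (LINT x|lborel. f x * cis (- 2 * pi * \<gamma> * x))"
    proof (rule integral_dominated_convergence)
      show "integrable lborel (\<lambda>x. norm (f x))" using f by simp
      show "AE x in lborel. (\<lambda>n. f x * cis (- 2 * pi * u n * x)) \<longlonglongrightarrow> f x * cis (- 2 * pi * \<gamma> * x)"
      proof (intro AE_I2)
        fix x show "(\<lambda>n. f x * cis (- 2 * pi * u n * x)) \<longlonglongrightarrow> f x * cis (- 2 * pi * \<gamma> * x)"
          unfolding cis_conv_exp using u by (intro tendsto_intros)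
      qed
      show "(\<lambda>x. f x * cis (- 2 * pi * \<gamma> * x)) \<in> borel_measurable lborel"
        "(\<lambda>x. f x * cis (- 2 * pi * u n * x)) \<in> borel_measurable lborel" for n
        using integrable_cis_mult[OF f] by (blast intro: borel_measurable_integrable)+
    qed (auto simp: norm_mult)
  qed
  then show ?thesis by (simp add: continuous_on_eq_continuous_at)
qed

lemma fourier_transform_affine:
  assumes "l > 0"
  shows "fourier_transform (\<lambda>x. f (l * x - b)) \<gamma> = fourier_transform f (\<gamma> / l) * cis (- 2 * pi * b / l * \<gamma>) / l"
proof -
  \<comment> \<open>After substituting \<open>- b + l * x\<close>, this phase cancels the constant
    phase caused by the shift \<open>b\<close>.\<close>
  define C where "C = cis (- 2 * pi * b / l * \<gamma>)"
  have "fourier_transform f (\<gamma> / l) * C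
      = (l *\<^sub>R (LINT x|lborel. f (- b + l * x) * cis (- 2 * pi * (\<gamma> / l) * (- b + l * x)))) * C"
    unfolding fourier_transform_cis using assms by (subst lborel_integral_real_affine[where c = l and t = "-b"]) auto
  also have "\<dots> = l *\<^sub>R (LINT x|lborel. f (- b + l * x) * cis (- 2 * pi * (\<gamma> / l) * (- b + l * x)) * C)"
    by (simp add: integral_mult_left_zero)
  also have "(LINT x|lborel. f (- b + l * x) * cis (- 2 * pi * (\<gamma> / l) * (- b + l * x)) * C)
     = fourier_transform (\<lambda>x. f (l * x - b)) \<gamma>"
    unfolding fourier_transform_cis C_def mult.assoc cis_mult
    using assms by (intro Bochner_Integration.integral_cong) (auto simp: field_simps)
  finally show ?thesis using assms by (simp add: C_def scaleR_conv_of_real)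
qed

text \<open>Adding the two bounds gives \<open>(1 + x^2) * |f x| \<le> 2 * B\<close>, so a multiple
  of \<open>1 / (1 + x^2)\<close> dominates \<open>f\<close>.\<close>

lemma integrable_inverse_square_bound:
  fixes f :: "real \<Rightarrow> complex"
  assumes cont: "continuous_on UNIV f" and B: "\<And>x. cmod (f x) \<le> B" "\<And>x. cmod (x ^ 2 *\<^sub>R f x) \<le> B"
  shows "integrable lborel f"
proof (rule Bochner_Integration.integrable_bound)
  have "integrable lborel (\<lambda>x::real. inverse (1 + x^2))"
    using integrable_inverse_1_plus_square by (simp add: set_integrable_def)
  then show "integrable lborel (\<lambda>x::real. 2 * B * inverse (1 + x^2))"
    by simp
  show "AE x in lborel. norm (f x) \<le> norm (2 * B * inverse (1 + x^2))"
  proof (intro AE_I2)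
    fix x
    have "(1 + x^2) * cmod (f x) \<le> 2 * B" using B[of x] by (simp add: algebra_simps)
    then have "cmod (f x) \<le> 2 * B * inverse (1 + x^2)"
      by (simp add: field_simps add_pos_nonneg pos_le_divide_eq)
    then show "norm (f x) \<le> norm (2 * B * inverse (1 + x^2))" by simp
  qed
qed (use cont in \<open>auto intro: borel_measurable_continuous_onI\<close>)

lemma fourier_transform_vector_derivative:
  fixes f g :: "real \<Rightarrow> complex"
  assumes f: "integrable lborel f" and g: "integrable lborel g" "continuous_on UNIV g"
    and deriv: "\<And>x. (f has_vector_derivative g x) (at x)"
    and lim: "(f \<longlongrightarrow> 0) at_top" "(f \<longlongrightarrow> 0) at_bot"
  shows "fourier_transform g \<gamma> = 2 * pi * \<i> * \<gamma> * fourier_transform f \<gamma>"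
proof -
  define w where "w = - 2 * pi * \<gamma>"
  \<comment> \<open>Integration by parts: \<open>h\<close> is the derivative of
    \<open>f x * cis (w * x)\<close>, which tends to 0 at both ends, so its integral over the line
    is 0.\<close>
  define h where "h = (\<lambda>x. g x * cis (w * x) + \<i> * w * (f x * cis (w * x)))"
  have cf: "continuous_on UNIV f"
    using deriv by (auto simp: continuous_on_eq_continuous_at intro: has_vector_derivative_continuous)
  have ig: "integrable lborel (\<lambda>x. g x * cis (w * x))" and if': "integrable lborel (\<lambda>x. f x * cis (w * x))"
    using f g integrable_cis_mult by blast+
  have int: "integrable lborel h" unfolding h_def using ig if' by simp
  have D: "((\<lambda>x. f x * cis (w * x)) has_vector_derivative h x) (at x)" for x
  proof -
    have "((\<lambda>x. cis (w * x)) has_vector_derivative \<i> * w * cis (w * x)) (at x)"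
      unfolding cis_conv_exp of_real_mult
      by (rule has_vector_derivative_real_field[where f = "\<lambda>z. exp (\<i> * (of_real w * z))"])
         (auto intro!: derivative_eq_intros)
    from has_vector_derivative_mult[OF deriv this] show ?thesis
      by (simp add: h_def algebra_simps)
  qed
  have lim0: "((\<lambda>x. f x * cis (w * x)) \<longlongrightarrow> 0) F" if "(f \<longlongrightarrow> 0) F" for F
    using that by (subst tendsto_norm_zero_iff[symmetric]) (simp add: norm_mult tendsto_norm_zero)
  have ch: "continuous_on UNIV h"
    unfolding h_def cis_conv_exp using cf g(2) by (intro continuous_intros)
  have "(LBINT x=-\<infinity>..\<infinity>. h x) = 0 - 0"
  proof (rule interval_integral_FTC_integrable)
    show "(((\<lambda>x. f x * cis (w * x)) \<circ> real_of_ereal) \<longlongrightarrow> 0) (at_right (- \<infinity>))"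
      "(((\<lambda>x. f x * cis (w * x)) \<circ> real_of_ereal) \<longlongrightarrow> 0) (at_left \<infinity>)"
      using lim0 lim by (auto simp: ereal_tendsto_simps)
  qed (use D int ch in \<open>auto simp: set_integrable_def continuous_on_eq_continuous_at\<close>)
  then have "(LINT x|lborel. h x) = 0"
    by (simp add: interval_lebesgue_integral_def set_lebesgue_integral_def)
  moreover have "(LINT x|lborel. h x) = fourier_transform g \<gamma> + \<i> * w * fourier_transform f \<gamma>"
    unfolding h_def fourier_transform_cis w_def[symmetric] using ig if' by simp
  ultimately show ?thesis by (simp add: w_def algebra_simps add_eq_0_iff)
qed

subsection \<open>Schwartz functions\<close>

lemma nth_vderiv_0: "nth_vderiv 0 f = f"
  by (simp add: nth_vderiv_def)

lemma nth_vderiv_Suc: "nth_vderiv (Suc n) f x = vector_derivative (nth_vderiv n f) (at x)"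
  by (simp add: nth_vderiv_def)

context
  fixes \<phi> :: "real \<Rightarrow> complex"
  assumes schwartz: "\<phi> \<in> schwartz_space"
begin

lemma schwartz_has_vector_derivative:
  "(nth_vderiv n \<phi> has_vector_derivative nth_vderiv (Suc n) \<phi> x) (at x)"
  using schwartz unfolding nth_vderiv_Suc
  by (auto simp: schwartz_space_def vector_derivative_works[symmetric])

lemma schwartz_continuous: "continuous_on UNIV (nth_vderiv n \<phi>)"
  using schwartz_has_vector_derivative has_vector_derivative_continuous
  by (metis continuous_on_eq_continuous_at open_UNIV)

lemma schwartz_bounded: "\<exists>B. \<forall>x. \<bar>x\<bar> ^ m * cmod (nth_vderiv n \<phi> x) \<le> B"
proof -
  have "bounded (range (\<lambda>x. x ^ m *\<^sub>R nth_vderiv n \<phi> x))"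
    using schwartz by (simp add: schwartz_space_def)
  then show ?thesis by (auto simp: bounded_iff power_abs)
qed

lemma schwartz_integrable: "integrable lborel (nth_vderiv n \<phi>)"
proof -
  obtain B0 B2 where B: "\<And>x. \<bar>x\<bar> ^ 0 * cmod (nth_vderiv n \<phi> x) \<le> B0" "\<And>x. \<bar>x\<bar> ^ 2 * cmod (nth_vderiv n \<phi> x) \<le> B2"
    using schwartz_bounded by meson
  show ?thesis
  proof (rule integrable_inverse_square_bound[OF schwartz_continuous])
    show "cmod (nth_vderiv n \<phi> x) \<le> max B0 B2" "cmod (x ^ 2 *\<^sub>R nth_vderiv n \<phi> x) \<le> max B0 B2" for x
      using B(1)[of x] B(2)[of x] by auto
  qed
qed

lemma schwartz_tendsto_0: "(nth_vderiv n \<phi> \<longlongrightarrow> 0) at_infinity"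
proof -
  obtain B where B: "\<And>x. \<bar>x\<bar> ^ 1 * cmod (nth_vderiv n \<phi> x) \<le> B"
    using schwartz_bounded by meson
  show ?thesis
  proof (rule Lim_null_comparison)
    show "\<forall>\<^sub>F x in at_infinity. norm (nth_vderiv n \<phi> x) \<le> B * inverse (norm x)"
      unfolding eventually_at_infinity
    proof (intro exI[of _ 1] allI impI)
      fix x :: real assume "1 \<le> norm x"
      then show "norm (nth_vderiv n \<phi> x) \<le> B * inverse (norm x)"
        using B[of x] by (simp add: field_simps)
    qed
    show "((\<lambda>x::real. B * inverse (norm x)) \<longlongrightarrow> 0) at_infinity"
      by (intro tendsto_mult_right_zero tendsto_inverse_0_at_top filterlim_norm_at_top)
  qed
qed

lemma fourier_transform_nth_vderiv:
  "fourier_transform (nth_vderiv n \<phi>) \<gamma> = (2 * pi * \<i> * \<gamma>) ^ n * fourier_transform \<phi> \<gamma>"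
proof (induction n)
  case (Suc n)
  have "fourier_transform (nth_vderiv (Suc n) \<phi>) \<gamma> = 2 * pi * \<i> * \<gamma> * fourier_transform (nth_vderiv n \<phi>) \<gamma>"
    using schwartz_tendsto_0[of n]
    by (intro fourier_transform_vector_derivative schwartz_integrable schwartz_continuous schwartz_has_vector_derivative)
       (auto intro: tendsto_mono[OF at_top_le_at_infinity] tendsto_mono[OF at_bot_le_at_infinity])
  then show ?case by (simp add: Suc)
qed (simp add: nth_vderiv_0)

text \<open>Up to the factor \<open>(2 * pi) ^ n\<close>, the left side is the modulus of the
  transform of the \<open>n\<close>-th derivative, hence bounded by the L1 norm of that
  derivative.\<close>

lemma fourier_transform_rapid_decay: "\<exists>M. \<forall>\<gamma>. \<bar>\<gamma>\<bar> ^ n * cmod (fourier_transform \<phi> \<gamma>) \<le> M"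
proof (intro exI allI)
  fix \<gamma>
  have "(2 * pi * \<bar>\<gamma>\<bar>) ^ n * cmod (fourier_transform \<phi> \<gamma>) = cmod (fourier_transform (nth_vderiv n \<phi>) \<gamma>)"
    by (simp add: fourier_transform_nth_vderiv norm_mult norm_power)
  also have "\<dots> \<le> (LINT x|lborel. cmod (nth_vderiv n \<phi> x * cis (- 2 * pi * \<gamma> * x)))"
    unfolding fourier_transform_cis by (rule integral_norm_bound)
  also have "\<dots> = (LINT x|lborel. cmod (nth_vderiv n \<phi> x))"
    by (simp add: norm_mult)
  finally have "(2 * pi) ^ n * (\<bar>\<gamma>\<bar> ^ n * cmod (fourier_transform \<phi> \<gamma>)) \<le> (LINT x|lborel. cmod (nth_vderiv n \<phi> x))"
    by (simp add: power_mult_distrib mult.assoc)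
  moreover have "0 < (2 * pi) ^ n" by simp
  ultimately show "\<bar>\<gamma>\<bar> ^ n * cmod (fourier_transform \<phi> \<gamma>) \<le> (LINT x|lborel. cmod (nth_vderiv n \<phi> x)) / (2 * pi) ^ n"
    by (simp only: pos_le_divide_eq mult.commute)
qed

text \<open>The point must avoid 0 because its sign selects a half-line. If the transform vanished
  off 0, continuity would make it vanish everywhere, and then injectivity would make
  \<open>\<phi>\<close> zero almost everywhere.\<close>

lemma fourier_transform_nonzero:
  assumes "\<phi> \<noteq> (\<lambda>x. 0)"
  shows "\<exists>\<gamma>. \<gamma> \<noteq> 0 \<and> fourier_transform \<phi> \<gamma> \<noteq> 0"
proof (rule ccontr)
  assume "\<not> ?thesis"
  then have zero: "fourier_transform \<phi> \<gamma> = 0" if "\<gamma> \<noteq> 0" for \<gamma> using that by blast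
  have int: "integrable lborel \<phi>" and cont: "continuous_on UNIV \<phi>"
    using schwartz_integrable[of 0] schwartz_continuous[of 0] by (auto simp: nth_vderiv_0)
  have "isCont (fourier_transform \<phi>) 0"
    using continuous_fourier_transform[OF int] by (simp add: continuous_on_eq_continuous_at)
  then have "fourier_transform \<phi> \<midarrow>0\<rightarrow> fourier_transform \<phi> 0" by (simp add: isCont_def)
  moreover have "fourier_transform \<phi> \<midarrow>0\<rightarrow> 0"
    by (rule tendsto_eventually) (auto simp: eventually_at_filter zero)
  ultimately have "fourier_transform \<phi> 0 = 0"
    using tendsto_unique[of "at (0::real)"] by auto
  with zero have all0: "fourier_transform \<phi> \<gamma> = 0" for \<gamma> by (cases "\<gamma> = 0") auto
  have "AE x in lborel. \<phi> x = 0"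
  proof (rule complex_fourier_injective[OF int])
    show "(LINT x|lborel. \<phi> x * cis (t * x)) = 0" for t
      using all0[of "- t / (2 * pi)"] by (simp add: fourier_transform_cis)
  qed
  \<comment> \<open>The zero set of a continuous function is closed, and a closed set of full
    measure is the whole line.\<close>
  then have ae: "AE x in lebesgue. x \<in> {x. \<phi> x = 0}"
    by (auto intro: AE_completion)
  have "closed {x. \<phi> x = 0}"
    using cont by (intro closed_Collect_eq) auto
  then have "\<phi> x = 0" for x
    using mem_closed_if_AE_lebesgue[OF _ ae] by auto
  then show False using assms by auto
qed

end

section \<open>Passage from wavelets to the dilation relation\<close>

theorem theorem3p4:
  fixes \<phi> :: "real \<Rightarrow> complex"
  assumes "\<phi> \<in> schwartz_space - {\<lambda>x. 0}"
    and "ultimately_decreasing (\<lambda>\<gamma>. cmod (fourier_transform \<phi> \<gamma>))"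
    and "ultimately_decreasing (\<lambda>\<gamma>. cmod (fourier_transform \<phi> (- \<gamma>)))"
  shows "\<forall>\<Lambda> :: (real \<times> real) set. finite \<Lambda> \<and> \<Lambda> \<subseteq> {0<..} \<times> UNIV \<longrightarrow>
           ae_linearly_independent \<Lambda> (wavelet \<phi>)"
proof (intro allI impI)
  fix \<Lambda> :: "(real \<times> real) set"
  assume \<Lambda>: "finite \<Lambda> \<and> \<Lambda> \<subseteq> {0<..} \<times> UNIV"
  then have pos: "fst k > 0" if "k \<in> \<Lambda>" for k using that by auto
  from assms(1) have S: "\<phi> \<in> schwartz_space" and "\<phi> \<noteq> (\<lambda>x. 0)" by auto
  have int: "integrable lborel \<phi>"
    using schwartz_integrable[OF S, of 0] by (simp add: nth_vderiv_0)
  have cont: "continuous_on UNIV (fourier_transform \<phi>)"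
    by (rule continuous_fourier_transform[OF int])
  show "ae_linearly_independent \<Lambda> (wavelet \<phi>)"
    unfolding ae_linearly_independent_def
  proof (intro allI impI)
    fix c :: "real \<times> real \<Rightarrow> complex"
    assume ae: "AE x in lborel. (\<Sum>k\<in>\<Lambda>. c k * wavelet \<phi> k x) = 0"
    have wint: "integrable lborel (wavelet \<phi> k)" if "k \<in> \<Lambda>" for k
      using lborel_integrable_real_affine[OF int, of "fst k" "- snd k"] pos[OF that]
      by (auto simp: wavelet_def case_prod_beta)
    \<comment> \<open>The division absorbs the Jacobian of the dilation by
      \<open>fst k\<close>.\<close>
    define C where "C = (\<lambda>k. c k / fst k)"
    have rel: "(\<Sum>k\<in>\<Lambda>. C k * fourier_transform \<phi> (\<gamma> / fst k) * cis (- 2 * pi * snd k / fst k * \<gamma>)) = 0" for \<gamma>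
    proof -
      have "0 = (LINT x|lborel. (\<Sum>k\<in>\<Lambda>. c k * wavelet \<phi> k x) * cis (- 2 * pi * \<gamma> * x))"
        using ae by (intro integral_eq_zero_AE[symmetric]) (auto elim: eventually_mono)
      also have "\<dots> = (LINT x|lborel. (\<Sum>k\<in>\<Lambda>. c k * (wavelet \<phi> k x * cis (- 2 * pi * \<gamma> * x))))"
        by (simp add: sum_distrib_right mult.assoc)
      also have "\<dots> = (\<Sum>k\<in>\<Lambda>. c k * fourier_transform (wavelet \<phi> k) \<gamma>)"
        unfolding fourier_transform_cis
        by (subst Bochner_Integration.integral_sum)
           (intro integrable_mult_right integrable_cis_mult wint, simp_all)
      also have "\<dots> = (\<Sum>k\<in>\<Lambda>. C k * fourier_transform \<phi> (\<gamma> / fst k) * cis (- 2 * pi * snd k / fst k * \<gamma>))"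
        using pos by (intro sum.cong refl) (simp add: wavelet_def case_prod_beta fourier_transform_affine C_def)
      finally show ?thesis by simp
    qed
    \<comment> \<open>Scale and frequency together recover the shift \<open>snd k\<close>. The two
      half-lines use \<open>r = -2 * pi\<close> and \<open>r = 2 * pi\<close>.\<close>
    have inj: "inj_on (\<lambda>k. (fst k, r * snd k / fst k)) \<Lambda>" if "r \<noteq> 0" for r :: real
      using that pos by (force simp: inj_on_def prod_eq_iff)
    obtain \<gamma>0 where \<gamma>0: "\<gamma>0 \<noteq> 0" "fourier_transform \<phi> \<gamma>0 \<noteq> 0"
      using fourier_transform_nonzero[OF S \<open>\<phi> \<noteq> (\<lambda>x. 0)\<close>] by blast
    have "\<forall>k\<in>\<Lambda>. C k = 0"
    proof (cases "\<gamma>0 > 0")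
      case True
      show ?thesis
      proof (rule dilation_relation_trivial[where F = "fourier_transform \<phi>" and l = fst
            and b = "\<lambda>k. - 2 * pi * snd k / fst k" and z = \<gamma>0])
        show "\<exists>M. \<forall>x>0. x ^ m * cmod (fourier_transform \<phi> x) \<le> M" for m
          using fourier_transform_rapid_decay[OF S, of m] by (metis abs_of_pos)
      qed (use \<Lambda> inj[of "-2 * pi"] pos cont assms(2) \<gamma>0 True rel in auto)
    next
      \<comment> \<open>Here \<open>\<gamma>0 < 0\<close>: reflecting the transform makes the
        nonzero point positive and flips the sign of the frequencies.\<close>
      case False
      show ?thesis
      proof (rule dilation_relation_trivial[where F = "\<lambda>x. fourier_transform \<phi> (- x)" and l = fst
            and b = "\<lambda>k. 2 * pi * snd k / fst k" and z = "- \<gamma>0"])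
        show "\<exists>M. \<forall>x>0. x ^ m * cmod (fourier_transform \<phi> (- x)) \<le> M" for m
          using fourier_transform_rapid_decay[OF S, of m] by (metis abs_minus_cancel abs_of_pos)
        show "continuous_on UNIV (\<lambda>x. fourier_transform \<phi> (- x))"
          by (intro continuous_on_compose2[OF cont] continuous_intros) auto
        show "(\<Sum>k\<in>\<Lambda>. C k * fourier_transform \<phi> (- (t / fst k)) * cis (2 * pi * snd k / fst k * t)) = 0" for t
          using rel[of "- t"] by simp
      qed (use \<Lambda> inj[of "2 * pi"] pos assms(3) \<gamma>0 False in auto)
    qed
    then show "\<forall>k\<in>\<Lambda>. c k = 0"
      using pos by (fastforce simp: C_def)
  qed
qed

end
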